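(* Let $I\subseteq\mathbb{R}$ be a nonempty open interval, let $f:I\to\mathbb{R}$ be a continuous and strictly increasing function, and let $(\xi_n)_{n\in\mathbb{N}}$ be a sequence of exchangeable random variables with values in $I$ such that $\mathbb{D}^2(f(\xi_1))\in(0,\infty)$. Let $\mu\in\mathbb{R}_+$ and let $L:I\to\mathbb{R}$ be a function such that $L\circ f^{-1}:f(I)\to\mathbb{R}$ is strongly convex with modulus $\mu$ and $\mathbb{E}(|L(\xi_1)|)<\infty$. Then, for each $n\in\mathbb{N}$, we have $\mathbb{E}\big(L(\mathscr{A}_n^{f}(\xi_1,\ldots,\xi_n))\big)\in[-\infty,\infty)$, and the sequence $$\bigg(\mathbb{E}\big(L(\mathscr{A}_n^{f}(\xi_1,\ldots,\xi_n))\big)-\frac{\mu(1-\varrho)}{n}\,\mathbb{D}^2(f(\xi_1))\bigg)_{n\in\mathbb{N}}$$ is decreasing, where $$\varrho:=\frac{\operatorname{Cov}(f(\xi_1),f(\xi_2))}{\sqrt{\mathbb{D}^2(f(\xi_1))\,\mathbb{D}^2(f(\xi_2))}}.$$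
   Context: $\mathbb{N}$ is the set of positive integers and $\mathbb{R}_+=[0,\infty)$. Quasi-arithmetic mean: for a nonempty open interval $I$, a continuous strictly increasing $f:I\to\mathbb{R}$ with inverse $f^{-1}:f(I)\to I$, and $n\in\mathbb{N}$, $\mathscr{A}_n^{f}:I^n\to I$ is $\mathscr{A}_n^{f}(x_1,\ldots,x_n):=f^{-1}\big(\frac1n\sum_{i=1}^n f(x_i)\big)$. Strong convexity: for a nondegenerate interval $J\subseteq\mathbb{R}$ and $\mu\in\mathbb{R}_+$, a function $\Lambda:J\to\mathbb{R}$ is strongly convex with modulus $\mu$ if $\Lambda(tx+(1-t)y)\leq t\Lambda(x)+(1-t)\Lambda(y)-\mu\, t(1-t)(x-y)^2$ for all $t\in[0,1]$ and $x,y\in J$ (no factor $1/2$). Exchangeability: a sequence $(\xi_n)_{n\in\mathbb{N}}$ of random variables is exchangeable if for every $n\in\mathbb{N}$ and every permutation $\sigma$ of $(1,\ldots,n)$ the law of $(\xi_{\sigma(1)},\ldots,\xi_{\sigma(n)})$ equals that of $(\xi_1,\ldots,\xi_n)$. $\mathbb{D}^2$ denotes variance and $\operatorname{Cov}$ covariance. "Decreasing" means non-increasing (with values in $[-\infty,\infty)$). An expectation is said to lie in $[-\infty,\infty)$ when the positive part is integrable, the expectation being $-\infty$ if the negative part is not integrable. *)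

theory Defs
  imports "HOL-Probability.Probability"
begin

text \<open>
  Sequences are indexed by the positive integers: a sequence is a function on \<^typ>\<open>nat\<close> of which
  only the values at indices \<open>\<ge> 1\<close> are ever used.
\<close>

definition quasi_arith_mean :: "real set \<Rightarrow> (real \<Rightarrow> real) \<Rightarrow> nat \<Rightarrow> (nat \<Rightarrow> real) \<Rightarrow> real" where
  "quasi_arith_mean I f n x = the_inv_into I f (1 / real n * (\<Sum>i=1..n. f (x i)))"

text \<open>As in \<^const>\<open>convex_on\<close>, convexity of the domain \<open>J\<close> (for real sets: being an interval) is
  part of the definition. There is no factor \<open>1/2\<close> in front of \<open>\<mu>\<close>.\<close>

definition strongly_convex_on :: "real set \<Rightarrow> real \<Rightarrow> (real \<Rightarrow> real) \<Rightarrow> bool" where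
  "strongly_convex_on J \<mu> \<Lambda> \<longleftrightarrow> convex J \<and>
     (\<forall>t\<in>{0..1}. \<forall>x\<in>J. \<forall>y\<in>J.
        \<Lambda> (t * x + (1 - t) * y) \<le> t * \<Lambda> x + (1 - t) * \<Lambda> y - \<mu> * t * (1 - t) * (x - y)\<^sup>2)"

definition exchangeable :: "'a measure \<Rightarrow> (nat \<Rightarrow> 'a \<Rightarrow> real) \<Rightarrow> bool" where
  "exchangeable M X \<longleftrightarrow>
     (\<forall>i\<ge>1. X i \<in> borel_measurable M) \<and>
     (\<forall>n\<ge>1. \<forall>\<sigma>. \<sigma> permutes {1..n} \<longrightarrow>
        distr M (PiM {1..n} (\<lambda>_. borel)) (\<lambda>\<omega>. \<lambda>i\<in>{1..n}. X (\<sigma> i) \<omega>) =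
        distr M (PiM {1..n} (\<lambda>_. borel)) (\<lambda>\<omega>. \<lambda>i\<in>{1..n}. X i \<omega>))"

definition covariance :: "'a measure \<Rightarrow> ('a \<Rightarrow> real) \<Rightarrow> ('a \<Rightarrow> real) \<Rightarrow> real" where
  "covariance M X Y = (\<integral>\<omega>. (X \<omega> - (\<integral>\<omega>'. X \<omega>' \<partial>M)) * (Y \<omega> - (\<integral>\<omega>'. Y \<omega>' \<partial>M)) \<partial>M)"

text \<open>
  The expectation as an extended real, positive part minus negative part. For measurable \<open>X\<close> with
  integrable positive part it is the usual expectation, being \<open>-\<infinity>\<close> if the negative part is not
  integrable. It is \<open>\<infinity>\<close> whenever the positive part has infinite integral, because
  \<open>\<infinity> - \<infinity> = \<infinity>\<close> in \<^typ>\<open>ereal\<close>.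
\<close>

definition ext_expectation :: "'a measure \<Rightarrow> ('a \<Rightarrow> real) \<Rightarrow> ereal" where
  "ext_expectation M X =
     enn2ereal (\<integral>\<^sup>+\<omega>. ennreal (max 0 (X \<omega>)) \<partial>M) - enn2ereal (\<integral>\<^sup>+\<omega>. ennreal (max 0 (- X \<omega>)) \<partial>M)"

end

theory Submission
  imports Defs
begin

text \<open>
  Write \<open>Y i = f (\<xi> i)\<close>, \<open>J = f ` I\<close>, \<open>\<Lambda> = L \<circ> f\<^sup>-\<^sup>1\<close> and let \<open>S n\<close> be the arithmetic mean of
  \<open>Y 1, \<dots>, Y n\<close>. Then \<open>L\<close> of the quasi-arithmetic mean is \<open>\<Lambda> (S n)\<close>, and the sequence \<open>Y\<close> is again
  exchangeable, so everything takes place on the open interval \<open>J\<close>.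

  Strong convexity of \<open>\<Lambda>\<close> with modulus \<open>\<mu>\<close> says exactly that \<open>g y = \<Lambda> y - \<mu> y\<^sup>2\<close> is convex
  (\<open>strongly_convex_on_imp_convex_on\<close>). On the other hand, exchangeability gives
  \<open>E[(S n)\<^sup>2] = E[Y 1 * Y 2] + (E[(Y 1)\<^sup>2] - E[Y 1 * Y 2]) / n\<close>
  (\<open>exchangeable_mean_second_moment\<close>), and \<open>E[(Y 1)\<^sup>2] - E[Y 1 * Y 2]\<close> is
  \<open>(1 - \<rho>)\<close> times the variance of \<open>Y 1\<close>. Hence the correction term \<open>\<mu> (1 - \<rho>) / n * Var (Y 1)\<close> is
  \<open>\<mu> E[(S n)\<^sup>2]\<close> up to a constant independent of \<open>n\<close>, and the sequence in question is
  \<open>E[g (S n)]\<close> shifted by that constant.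

  It remains to see that \<open>E[g (S n)]\<close> decreases for convex \<open>g\<close>
  (\<open>exchangeable_convex_mean_Suc_le\<close>). The mean \<open>S (n + 1)\<close> is the average of the \<open>n + 1\<close> means
  obtained by leaving out one of \<open>Y 1, \<dots>, Y (n + 1)\<close>; by exchangeability each of them has the law of
  \<open>S n\<close>, so Jensen's inequality for this finite average gives the claim after taking expectations.

  All expectations are in fact finite: a convex function on an open interval has an affine minorant,
  so \<open>g (S n)\<close> is bounded below by an integrable function, and above by the mean of the
  \<open>g (Y i)\<close>. The extended expectations are therefore ordinary integrals.
\<close>

section \<open>Exchangeable sequences\<close>

lemma exchangeable_measurable:
  assumes "exchangeable M X" "i \<ge> 1"
  shows "X i \<in> borel_measurable M"
  using assms by (auto simp: exchangeable_def)

lemma exchangeable_borel_image: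
  assumes X: "exchangeable M X" and h [measurable]: "h \<in> borel_measurable borel"
  shows "exchangeable M (\<lambda>i \<omega>. h (X i \<omega>))"
  unfolding exchangeable_def
proof (intro conjI allI impI)
  fix i :: nat assume "i \<ge> 1"
  with X have [measurable]: "X i \<in> borel_measurable M"
    by (rule exchangeable_measurable)
  show "(\<lambda>\<omega>. h (X i \<omega>)) \<in> borel_measurable M"
    by measurable
next
  fix n :: nat and \<sigma> :: "nat \<Rightarrow> nat"
  assume n: "n \<ge> 1" and \<sigma>: "\<sigma> permutes {1..n}"
  let ?P = "PiM {1..n} (\<lambda>_. borel :: real measure)"
  let ?G = "\<lambda>x. \<lambda>i\<in>{1..n}. h (x i)"
  have G: "?G \<in> measurable ?P ?P"
    by measurable
  have eq: "distr M ?P (\<lambda>\<omega>. \<lambda>i\<in>{1..n}. h (X (\<tau> i) \<omega>)) =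
      distr (distr M ?P (\<lambda>\<omega>. \<lambda>i\<in>{1..n}. X (\<tau> i) \<omega>)) ?P ?G"
    if \<tau>: "\<tau> permutes {1..n}" for \<tau>
  proof -
    have "(\<lambda>\<omega>. \<lambda>i\<in>{1..n}. X (\<tau> i) \<omega>) \<in> measurable M ?P"
      using permutes_in_image[OF \<tau>] by (intro measurable_restrict exchangeable_measurable[OF X]) auto
    then show ?thesis
      using G by (subst distr_distr) (auto simp: comp_def intro!: distr_cong)
  qed
  show "distr M ?P (\<lambda>\<omega>. \<lambda>i\<in>{1..n}. h (X (\<sigma> i) \<omega>)) = distr M ?P (\<lambda>\<omega>. \<lambda>i\<in>{1..n}. h (X i \<omega>))"
    using eq[OF \<sigma>] eq[OF permutes_id] X n \<sigma> by (simp add: exchangeable_def)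
qed

lemma exchangeable_integral:
  fixes H :: "(nat \<Rightarrow> real) \<Rightarrow> real"
  assumes X: "exchangeable M X" and n: "n \<ge> 1" and \<sigma>: "\<sigma> permutes {1..n}"
    and H: "H \<in> borel_measurable (PiM {1..n} (\<lambda>_. borel))"
  shows "integrable M (\<lambda>\<omega>. H (\<lambda>i\<in>{1..n}. X (\<sigma> i) \<omega>)) \<longleftrightarrow>
           integrable M (\<lambda>\<omega>. H (\<lambda>i\<in>{1..n}. X i \<omega>))" (is ?int)
    and "(\<integral>\<omega>. H (\<lambda>i\<in>{1..n}. X (\<sigma> i) \<omega>) \<partial>M) = (\<integral>\<omega>. H (\<lambda>i\<in>{1..n}. X i \<omega>) \<partial>M)" (is ?eq)
proof -
  let ?P = "PiM {1..n} (\<lambda>_. borel :: real measure)"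
  have meas: "(\<lambda>\<omega>. \<lambda>i\<in>{1..n}. X (\<tau> i) \<omega>) \<in> measurable M ?P" if "\<tau> permutes {1..n}" for \<tau>
    using permutes_in_image[OF that]
    by (intro measurable_restrict exchangeable_measurable[OF X]) auto
  have distr: "distr M ?P (\<lambda>\<omega>. \<lambda>i\<in>{1..n}. X (\<sigma> i) \<omega>) = distr M ?P (\<lambda>\<omega>. \<lambda>i\<in>{1..n}. X i \<omega>)"
    using X n \<sigma> by (auto simp: exchangeable_def)
  have id: "(\<lambda>\<omega>. \<lambda>i\<in>{1..n}. X i \<omega>) \<in> measurable M ?P"
    using meas[OF permutes_id] by simp
  show ?int
    using integrable_distr_eq[OF meas[OF \<sigma>] H] integrable_distr_eq[OF id H] distr by simp
  show ?eq
    using integral_distr[OF meas[OF \<sigma>] H] integral_distr[OF id H] distr by simp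
qed

lemma exchangeable_marginal:
  fixes h :: "real \<Rightarrow> real"
  assumes X: "exchangeable M X" and i: "i \<ge> 1" and h [measurable]: "h \<in> borel_measurable borel"
  shows "integrable M (\<lambda>\<omega>. h (X i \<omega>)) \<longleftrightarrow> integrable M (\<lambda>\<omega>. h (X 1 \<omega>))"
    and "(\<integral>\<omega>. h (X i \<omega>) \<partial>M) = (\<integral>\<omega>. h (X 1 \<omega>) \<partial>M)"
proof -
  have \<sigma>: "Transposition.transpose 1 i permutes {1..i}"
    using i by (intro permutes_swap_id) auto
  have one: "1 \<in> {1..i}"
    using i by simp
  then have H: "(\<lambda>x. h (x 1)) \<in> borel_measurable (PiM {1..i} (\<lambda>_. borel))"
    by measurable
  show "integrable M (\<lambda>\<omega>. h (X i \<omega>)) \<longleftrightarrow> integrable M (\<lambda>\<omega>. h (X 1 \<omega>))"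
    using exchangeable_integral(1)[OF X i \<sigma> H] i by simp
  show "(\<integral>\<omega>. h (X i \<omega>) \<partial>M) = (\<integral>\<omega>. h (X 1 \<omega>) \<partial>M)"
    using exchangeable_integral(2)[OF X i \<sigma> H] i by simp
qed

lemma exchangeable_product_expectation:
  assumes X: "exchangeable M X" and ij: "i \<ge> 1" "j \<ge> 1" "i \<noteq> j"
  shows "(\<integral>\<omega>. X i \<omega> * X j \<omega> \<partial>M) = (\<integral>\<omega>. X 1 \<omega> * X 2 \<omega> \<partial>M)"
proof -
  define n where "n = max 2 (max i j)"
  define \<tau> where "\<tau> = Transposition.transpose 1 i"
  \<comment> \<open>A permutation with \<open>1 \<mapsto> i\<close> and \<open>2 \<mapsto> j\<close>: since \<open>j \<noteq> i\<close>, we have \<open>\<tau> j \<noteq> 1\<close>, so the inner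
    transposition fixes \<open>1\<close>.\<close>
  define \<sigma> where "\<sigma> = \<tau> \<circ> Transposition.transpose 2 (\<tau> j)"
  have n: "n \<ge> 1" "1 \<in> {1..n}" "2 \<in> {1..n}" "i \<in> {1..n}" "j \<in> {1..n}"
    using ij by (auto simp: n_def)
  have \<tau>: "\<tau> permutes {1..n}"
    unfolding \<tau>_def using n by (intro permutes_swap_id)
  have \<sigma>: "\<sigma> permutes {1..n}"
    unfolding \<sigma>_def using n permutes_in_image[OF \<tau>, of j]
    by (intro permutes_compose \<tau> permutes_swap_id) auto
  have "\<tau> j \<noteq> 1"
    using ij by (auto simp: \<tau>_def Transposition.transpose_def split: if_splits)
  then have "\<sigma> 1 = i" "\<sigma> 2 = j"
    by (auto simp: \<sigma>_def \<tau>_def transpose_apply_other)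
  moreover have H: "(\<lambda>x. x 1 * x 2) \<in> borel_measurable (PiM {1..n} (\<lambda>_. borel :: real measure))"
    using n by measurable
  ultimately show ?thesis
    using exchangeable_integral(2)[OF X n(1) \<sigma> H] n by simp
qed

text \<open>Swapping \<open>j\<close> with the last index \<open>n + 1\<close> turns the first \<open>n\<close> indices into all indices
  other than \<open>j\<close>; so a mean with one term left out has the law of the mean of the first \<open>n\<close> terms.\<close>

lemma exchangeable_mean_leave_one_out:
  fixes g :: "real \<Rightarrow> real"
  assumes X: "exchangeable M X" and j: "j \<in> {1..Suc n}"
    and g [measurable]: "g \<in> borel_measurable borel"
  shows "(\<integral>\<omega>. g (1 / real n * (\<Sum>k\<in>{1..Suc n} - {j}. X k \<omega>)) \<partial>M) =
           (\<integral>\<omega>. g (1 / real n * (\<Sum>k=1..n. X k \<omega>)) \<partial>M)"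
proof -
  define \<sigma> where "\<sigma> = Transposition.transpose j (Suc n)"
  have \<sigma>: "\<sigma> permutes {1..Suc n}"
    unfolding \<sigma>_def using j by (intro permutes_swap_id) auto
  have "{1..n} = {1..Suc n} - {Suc n}"
    by auto
  also have "\<sigma> ` \<dots> = \<sigma> ` {1..Suc n} - \<sigma> ` {Suc n}"
    using permutes_inj[OF \<sigma>] by (rule image_set_diff)
  also have "\<dots> = {1..Suc n} - {j}"
    unfolding permutes_image[OF \<sigma>] by (simp add: \<sigma>_def)
  finally have "\<sigma> ` {1..n} = {1..Suc n} - {j}" .
  then have reindex: "(\<Sum>k\<in>{1..Suc n} - {j}. X k \<omega>) = (\<Sum>k=1..n. X (\<sigma> k) \<omega>)" for \<omega>
    using sum.reindex[of \<sigma> "{1..n}" "\<lambda>k. X k \<omega>"] permutes_inj_on[OF \<sigma>] by (simp add: comp_def)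
  let ?H = "\<lambda>x. g (1 / real n * (\<Sum>k=1..n. x k))"
  have H: "?H \<in> borel_measurable (PiM {1..Suc n} (\<lambda>_. borel))"
    by measurable
  have restr: "(\<Sum>k=1..n. (\<lambda>i\<in>{1..Suc n}. Z i) k) = (\<Sum>k=1..n. Z k)" for Z :: "nat \<Rightarrow> real"
    by (intro sum.cong) auto
  show "(\<integral>\<omega>. g (1 / real n * (\<Sum>k\<in>{1..Suc n} - {j}. X k \<omega>)) \<partial>M) =
           (\<integral>\<omega>. g (1 / real n * (\<Sum>k=1..n. X k \<omega>)) \<partial>M)"
    using exchangeable_integral(2)[OF X _ \<sigma> H] unfolding restr reindex by simp
qed

lemma integrable_mult_of_squares:
  fixes U V :: "'a \<Rightarrow> real"
  assumes [measurable]: "U \<in> borel_measurable M" "V \<in> borel_measurable M"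
    and sq: "integrable M (\<lambda>\<omega>. (U \<omega>)\<^sup>2)" "integrable M (\<lambda>\<omega>. (V \<omega>)\<^sup>2)"
  shows "integrable M (\<lambda>\<omega>. U \<omega> * V \<omega>)"
proof (rule Bochner_Integration.integrable_bound)
  show "integrable M (\<lambda>\<omega>. (U \<omega>)\<^sup>2 + (V \<omega>)\<^sup>2)"
    using sq by auto
  have "\<bar>a * b\<bar> \<le> a\<^sup>2 + b\<^sup>2" for a b :: real
  proof -
    have "2 * \<bar>a * b\<bar> \<le> a\<^sup>2 + b\<^sup>2"
      using sum_squares_bound[of "\<bar>a\<bar>" "\<bar>b\<bar>"] by (simp add: abs_mult)
    moreover have "0 \<le> \<bar>a * b\<bar>"
      by (rule abs_ge_zero)
    ultimately show ?thesis
      by linarith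
  qed
  then show "AE \<omega> in M. norm (U \<omega> * V \<omega>) \<le> norm ((U \<omega>)\<^sup>2 + (V \<omega>)\<^sup>2)"
    by simp
qed measurable

text \<open>Expanding the square gives \<open>n\<close> diagonal terms, all with the expectation of the square of
  \<open>X 1\<close>, and \<open>n (n - 1)\<close> mixed terms, all with the expectation of \<open>X 1 * X 2\<close>.\<close>

lemma exchangeable_mean_second_moment:
  assumes X: "exchangeable M X" and sq: "integrable M (\<lambda>\<omega>. (X 1 \<omega>)\<^sup>2)" and n: "n \<ge> 1"
  shows "integrable M (\<lambda>\<omega>. (1 / real n * (\<Sum>i=1..n. X i \<omega>))\<^sup>2)"
    and "(\<integral>\<omega>. (1 / real n * (\<Sum>i=1..n. X i \<omega>))\<^sup>2 \<partial>M) =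
      (\<integral>\<omega>. X 1 \<omega> * X 2 \<omega> \<partial>M) + ((\<integral>\<omega>. (X 1 \<omega>)\<^sup>2 \<partial>M) - (\<integral>\<omega>. X 1 \<omega> * X 2 \<omega> \<partial>M)) / real n"
proof -
  let ?v = "\<integral>\<omega>. (X 1 \<omega>)\<^sup>2 \<partial>M" and ?q = "\<integral>\<omega>. X 1 \<omega> * X 2 \<omega> \<partial>M"
  have sq': "integrable M (\<lambda>\<omega>. (X i \<omega>)\<^sup>2)" "(\<integral>\<omega>. (X i \<omega>)\<^sup>2 \<partial>M) = ?v" if "i \<ge> 1" for i
    using exchangeable_marginal[OF X that, of "\<lambda>x. x\<^sup>2"] sq by auto
  have prod: "integrable M (\<lambda>\<omega>. X i \<omega> * X j \<omega>)" if "i \<ge> 1" "j \<ge> 1" for i j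
    using exchangeable_measurable[OF X] sq'(1) that by (intro integrable_mult_of_squares) auto
  have expand: "(1 / real n * (\<Sum>i=1..n. X i \<omega>))\<^sup>2 =
      (1 / real n)\<^sup>2 * (\<Sum>i=1..n. \<Sum>j=1..n. X i \<omega> * X j \<omega>)" for \<omega>
    by (simp only: power_mult_distrib power2_eq_square[of "sum _ _"] sum_product)
  show "integrable M (\<lambda>\<omega>. (1 / real n * (\<Sum>i=1..n. X i \<omega>))\<^sup>2)"
    unfolding expand using prod
    by (intro integrable_mult_right Bochner_Integration.integrable_sum) auto
  have "(\<integral>\<omega>. (\<Sum>i=1..n. \<Sum>j=1..n. X i \<omega> * X j \<omega>) \<partial>M) =
      (\<Sum>i=1..n. \<Sum>j=1..n. \<integral>\<omega>. X i \<omega> * X j \<omega> \<partial>M)"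
  proof -
    have "(\<integral>\<omega>. (\<Sum>i=1..n. \<Sum>j=1..n. X i \<omega> * X j \<omega>) \<partial>M) =
        (\<Sum>i=1..n. \<integral>\<omega>. (\<Sum>j=1..n. X i \<omega> * X j \<omega>) \<partial>M)"
      using prod by (intro Bochner_Integration.integral_sum Bochner_Integration.integrable_sum) auto
    also have "\<dots> = (\<Sum>i=1..n. \<Sum>j=1..n. \<integral>\<omega>. X i \<omega> * X j \<omega> \<partial>M)"
      using prod by (intro sum.cong refl Bochner_Integration.integral_sum) auto
    finally show ?thesis .
  qed
  also have "\<dots> = (\<Sum>i=1..n. \<Sum>j=1..n. ?q + (if i = j then ?v - ?q else 0))"
  proof (intro sum.cong refl)
    fix i j assume ij: "i \<in> {1..n}" "j \<in> {1..n}"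
    show "(\<integral>\<omega>. X i \<omega> * X j \<omega> \<partial>M) = ?q + (if i = j then ?v - ?q else 0)"
    proof (cases "i = j")
      case True
      then show ?thesis
        using sq'(2)[of j] ij by (simp add: power2_eq_square)
    next
      case False
      then show ?thesis
        using exchangeable_product_expectation[OF X, of i j] ij by simp
    qed
  qed
  also have "\<dots> = (real n)\<^sup>2 * ?q + real n * (?v - ?q)"
    by (simp add: sum.distrib sum.delta power2_eq_square distrib_left)
  finally have "(\<integral>\<omega>. (\<Sum>i=1..n. \<Sum>j=1..n. X i \<omega> * X j \<omega>) \<partial>M) = (real n)\<^sup>2 * ?q + real n * (?v - ?q)" .
  moreover have "(1 / N)\<^sup>2 * (N\<^sup>2 * a + N * d) = a + d / N" if "N \<noteq> 0" for N a d :: real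
    using that by (simp add: power2_eq_square field_simps)
  ultimately show "(\<integral>\<omega>. (1 / real n * (\<Sum>i=1..n. X i \<omega>))\<^sup>2 \<partial>M) = ?q + (?v - ?q) / real n"
    unfolding expand using n by simp
qed

section \<open>Convex functions of the means\<close>

text \<open>The defect of the square function in the convexity inequality is exactly
  \<open>t (1 - t) (x - y)\<^sup>2\<close>, so the strong convexity term is absorbed by subtracting \<open>\<mu> x\<^sup>2\<close>.\<close>

lemma strongly_convex_on_imp_convex_on:
  assumes "strongly_convex_on J \<mu> \<Lambda>"
  shows "convex_on J (\<lambda>x. \<Lambda> x - \<mu> * x\<^sup>2)"
  unfolding convex_on_alt
proof (intro conjI ballI allI impI)
  show "convex J"
    using assms by (simp add: strongly_convex_on_def)
  fix x y t :: real
  assume xy: "x \<in> J" "y \<in> J" and t: "0 \<le> t \<and> t \<le> 1"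
  have "\<mu> * t * (1 - t) * (x - y)\<^sup>2 + \<mu> * (t * x + (1 - t) * y)\<^sup>2 = t * (\<mu> * x\<^sup>2) + (1 - t) * (\<mu> * y\<^sup>2)"
    by algebra
  moreover have "\<Lambda> (t * x + (1 - t) * y) \<le> t * \<Lambda> x + (1 - t) * \<Lambda> y - \<mu> * t * (1 - t) * (x - y)\<^sup>2"
    using assms xy t by (auto simp: strongly_convex_on_def)
  ultimately show "\<Lambda> (t *\<^sub>R x + (1 - t) *\<^sub>R y) - \<mu> * (t *\<^sub>R x + (1 - t) *\<^sub>R y)\<^sup>2
      \<le> t * (\<Lambda> x - \<mu> * x\<^sup>2) + (1 - t) * (\<Lambda> y - \<mu> * y\<^sup>2)"
    by (simp add: right_diff_distrib)
qed

lemma convex_on_affine_minorant: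
  fixes g :: "real \<Rightarrow> real"
  assumes "open J" "convex_on J g"
  obtains a b where "\<And>x. x \<in> J \<Longrightarrow> a + b * x \<le> g x"
proof (cases "J = {}")
  case False
  then obtain z where z: "z \<in> interior J"
    using assms(1) by (auto simp: interior_open)
  define s where "s = Inf ((\<lambda>t. (g z - g t) / (z - t)) ` ({z<..} \<inter> J))"
  have "(g z - s * z) + s * x \<le> g x" if "x \<in> J" for x
    using convex_le_Inf_differential[OF assms(2) z that] by (simp add: s_def right_diff_distrib)
  then show ?thesis
    by (rule that)
qed (use that in auto)

lemma borel_measurable_convex_on_compose:
  fixes g :: "real \<Rightarrow> real"
  assumes "open J" "convex_on J g" and Z: "Z \<in> borel_measurable M" "\<And>\<omega>. \<omega> \<in> space M \<Longrightarrow> Z \<omega> \<in> J"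
  shows "(\<lambda>\<omega>. g (Z \<omega>)) \<in> borel_measurable M"
proof -
  have "(\<lambda>x. indicator J x *\<^sub>R g x) \<in> borel_measurable borel"
    using assms convex_on_continuous by (intro borel_measurable_continuous_on_indicator) auto
  from measurable_compose[OF Z(1) this] show ?thesis
    using Z(2) by (subst (asm) measurable_cong[where g = "\<lambda>\<omega>. g (Z \<omega>)"]) auto
qed

lemma mean_in_convex:
  fixes y :: "'i \<Rightarrow> real"
  assumes "convex J" "finite A" "A \<noteq> {}" "\<And>i. i \<in> A \<Longrightarrow> y i \<in> J"
  shows "1 / real (card A) * (\<Sum>i\<in>A. y i) \<in> J"
  using convex_sum[of A J "\<lambda>_. 1 / real (card A)" y] assms
  by (simp add: sum_distrib_left card_gt_0_iff)

lemma convex_on_mean_le: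
  fixes y :: "'i \<Rightarrow> real"
  assumes "convex_on J g" "finite A" "A \<noteq> {}" "\<And>i. i \<in> A \<Longrightarrow> y i \<in> J"
  shows "g (1 / real (card A) * (\<Sum>i\<in>A. y i)) \<le> 1 / real (card A) * (\<Sum>i\<in>A. g (y i))"
  using convex_on_sum[of A J g "\<lambda>_. 1 / real (card A)" y] assms
  by (simp add: sum_distrib_left card_gt_0_iff)

text \<open>An affine minorant from below and Jensen's inequality from above squeeze \<open>g\<close> of the mean
  between two integrable functions.\<close>

lemma integrable_convex_mean:
  fixes Y :: "nat \<Rightarrow> 'a \<Rightarrow> real" and g :: "real \<Rightarrow> real"
  assumes M: "finite_measure M" and J: "open J" "convex_on J g"
    and Y: "\<And>i \<omega>. i \<in> A \<Longrightarrow> \<omega> \<in> space M \<Longrightarrow> Y i \<omega> \<in> J" "\<And>i. i \<in> A \<Longrightarrow> integrable M (Y i)"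
      "\<And>i. i \<in> A \<Longrightarrow> integrable M (\<lambda>\<omega>. g (Y i \<omega>))"
    and A: "finite A" "A \<noteq> {}"
  shows "integrable M (\<lambda>\<omega>. g (1 / real (card A) * (\<Sum>i\<in>A. Y i \<omega>)))"
proof -
  interpret finite_measure M by (rule M)
  let ?S = "\<lambda>\<omega>. 1 / real (card A) * (\<Sum>i\<in>A. Y i \<omega>)"
  have inJ: "?S \<omega> \<in> J" if "\<omega> \<in> space M" for \<omega>
    using J A Y that by (intro mean_in_convex) (auto simp: convex_on_def)
  have S: "integrable M ?S"
    using Y by auto
  obtain a b where ab: "\<And>x. x \<in> J \<Longrightarrow> a + b * x \<le> g x"
    using convex_on_affine_minorant[OF J] by blast
  let ?B = "\<lambda>\<omega>. 1 / real (card A) * (\<Sum>i\<in>A. g (Y i \<omega>))"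
  show ?thesis
  proof (rule Bochner_Integration.integrable_bound)
    show "integrable M (\<lambda>\<omega>. \<bar>a + b * ?S \<omega>\<bar> + \<bar>?B \<omega>\<bar>)"
      by (intro Bochner_Integration.integrable_add integrable_abs S Y(3)
          integrable_mult_right Bochner_Integration.integrable_sum integrable_const)
    show "(\<lambda>\<omega>. g (?S \<omega>)) \<in> borel_measurable M"
      using S inJ by (intro borel_measurable_convex_on_compose[OF J]) auto
    have "\<bar>g (?S \<omega>)\<bar> \<le> \<bar>a + b * ?S \<omega>\<bar> + \<bar>?B \<omega>\<bar>" if "\<omega> \<in> space M" for \<omega>
    proof -
      have "g (?S \<omega>) \<le> ?B \<omega>"
        using Y(1) that by (intro convex_on_mean_le[OF J(2) A])
      with ab[OF inJ[OF that]] show ?thesis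
        by linarith
    qed
    then show "AE \<omega> in M. norm (g (?S \<omega>)) \<le> norm (\<bar>a + b * ?S \<omega>\<bar> + \<bar>?B \<omega>\<bar>)"
      by auto
  qed
qed

text \<open>Every term occurs in all but one of the \<open>n + 1\<close> inner sums, that is, \<open>n\<close> times in total.\<close>

lemma mean_eq_mean_leave_one_out:
  fixes y :: "nat \<Rightarrow> real"
  assumes n: "n \<ge> 1"
  shows "1 / real (Suc n) * (\<Sum>i=1..Suc n. y i) =
    1 / real (Suc n) * (\<Sum>j=1..Suc n. 1 / real n * (\<Sum>k\<in>{1..Suc n} - {j}. y k))"
proof -
  have "(\<Sum>j=1..Suc n. \<Sum>k\<in>{1..Suc n} - {j}. y k) = (\<Sum>j=1..Suc n. (\<Sum>k=1..Suc n. y k) - y j)"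
    by (intro sum.cong refl) (simp add: sum_diff1)
  also have "\<dots> = real n * (\<Sum>k=1..Suc n. y k)"
    by (simp only: sum_subtractf) (simp add: algebra_simps)
  finally show ?thesis
    using n by (simp only: sum_distrib_left[symmetric]) simp
qed

text \<open>Jensen's inequality is applied to the mean of \<open>n + 1\<close> terms, written as the average of its
  leave-one-out means; exchangeability makes the expectations of \<open>g\<close> at the latter all equal.\<close>

lemma exchangeable_convex_mean_Suc_le:
  fixes Y :: "nat \<Rightarrow> 'a \<Rightarrow> real" and g :: "real \<Rightarrow> real"
  assumes M: "finite_measure M" and J: "open J" "convex_on J g" and Y: "exchangeable M Y"
    and YJ: "\<And>i \<omega>. i \<ge> 1 \<Longrightarrow> \<omega> \<in> space M \<Longrightarrow> Y i \<omega> \<in> J"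
    and int: "integrable M (Y 1)" "integrable M (\<lambda>\<omega>. g (Y 1 \<omega>))" and n: "n \<ge> 1"
  shows "integrable M (\<lambda>\<omega>. g (1 / real n * (\<Sum>i=1..n. Y i \<omega>)))" (is ?integrable)
    and "(\<integral>\<omega>. g (1 / real (Suc n) * (\<Sum>i=1..Suc n. Y i \<omega>)) \<partial>M) \<le>
      (\<integral>\<omega>. g (1 / real n * (\<Sum>i=1..n. Y i \<omega>)) \<partial>M)" (is ?le)
proof -
  \<comment> \<open>Equality of laws is tested against Borel functions on the whole line, so \<open>g\<close> is extended by
    \<open>0\<close> outside \<open>J\<close>.\<close>
  define h where "h x = indicator J x *\<^sub>R g x" for x
  have h: "h \<in> borel_measurable borel"
    unfolding h_def using J convex_on_continuous
    by (intro borel_measurable_continuous_on_indicator) auto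
  have hg: "h x = g x" if "x \<in> J" for x
    using that by (simp add: h_def)
  have int_Y: "integrable M (Y i)" if "i \<ge> 1" for i
    using exchangeable_marginal(1)[OF Y that, of "\<lambda>x. x"] int by simp
  have int_g: "integrable M (\<lambda>\<omega>. g (Y i \<omega>))" if "i \<ge> 1" for i
  proof -
    have "integrable M (\<lambda>\<omega>. h (Y i \<omega>)) \<longleftrightarrow> integrable M (\<lambda>\<omega>. g (Y i \<omega>))" if "i \<ge> 1" for i
      using YJ[OF that] by (intro Bochner_Integration.integrable_cong) (auto simp: hg)
    then show ?thesis
      using exchangeable_marginal(1)[OF Y that h] that int by simp
  qed
  have mean_int: "integrable M (\<lambda>\<omega>. g (1 / real (card A) * (\<Sum>i\<in>A. Y i \<omega>)))"
    if "finite A" "A \<noteq> {}" "A \<subseteq> {1..}" for A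
    using that YJ int_Y int_g by (intro integrable_convex_mean[OF M J]) auto
  show ?integrable
    using mean_int[of "{1..n}"] n by simp
  let ?T = "\<lambda>j \<omega>. 1 / real n * (\<Sum>k\<in>{1..Suc n} - {j}. Y k \<omega>)"
  have A: "finite ({1..Suc n} - {j})" "{1..Suc n} - {j} \<noteq> {}" "{1..Suc n} - {j} \<subseteq> {1..}"
    "card ({1..Suc n} - {j}) = n" if j: "j \<in> {1..Suc n}" for j
  proof -
    show card: "card ({1..Suc n} - {j}) = n"
      using j by simp
    show "{1..Suc n} - {j} \<noteq> {}"
      using card n by (metis card.empty not_one_le_zero)
  qed auto
  have TJ: "?T j \<omega> \<in> J" if j: "j \<in> {1..Suc n}" and \<omega>: "\<omega> \<in> space M" for j \<omega>
    using mean_in_convex[of J "{1..Suc n} - {j}" "\<lambda>k. Y k \<omega>", OF _ A(1,2)[OF j], unfolded A(4)[OF j]]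
      J(2) YJ[OF _ \<omega>] by (simp add: convex_on_def)
  have intT: "integrable M (\<lambda>\<omega>. g (?T j \<omega>))" if j: "j \<in> {1..Suc n}" for j
    using mean_int[OF A(1-3)[OF j]] unfolding A(4)[OF j] .
  have same: "(\<integral>\<omega>. g (?T j \<omega>) \<partial>M) = (\<integral>\<omega>. g (1 / real n * (\<Sum>i=1..n. Y i \<omega>)) \<partial>M)"
    if j: "j \<in> {1..Suc n}" for j
  proof -
    have "1 / real n * (\<Sum>i=1..n. Y i \<omega>) \<in> J" if "\<omega> \<in> space M" for \<omega>
      using mean_in_convex[of J "{1..n}" "\<lambda>k. Y k \<omega>"] J(2) YJ that n by (auto simp: convex_on_def)
    then have "(\<integral>\<omega>. h (1 / real n * (\<Sum>i=1..n. Y i \<omega>)) \<partial>M) =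
        (\<integral>\<omega>. g (1 / real n * (\<Sum>i=1..n. Y i \<omega>)) \<partial>M)"
      by (intro Bochner_Integration.integral_cong refl hg)
    moreover have "(\<integral>\<omega>. h (?T j \<omega>) \<partial>M) = (\<integral>\<omega>. g (?T j \<omega>) \<partial>M)"
      using TJ[OF j] by (intro Bochner_Integration.integral_cong refl hg)
    ultimately show ?thesis
      using exchangeable_mean_leave_one_out[OF Y j h] by simp
  qed
  have "(\<integral>\<omega>. g (1 / real (Suc n) * (\<Sum>i=1..Suc n. Y i \<omega>)) \<partial>M) \<le>
      (\<integral>\<omega>. 1 / real (Suc n) * (\<Sum>j=1..Suc n. g (?T j \<omega>)) \<partial>M)"
  proof (rule integral_mono)
    show "integrable M (\<lambda>\<omega>. g (1 / real (Suc n) * (\<Sum>i=1..Suc n. Y i \<omega>)))"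
      using mean_int[of "{1..Suc n}"] by simp
    show "integrable M (\<lambda>\<omega>. 1 / real (Suc n) * (\<Sum>j=1..Suc n. g (?T j \<omega>)))"
      using intT by (intro integrable_mult_right Bochner_Integration.integrable_sum) auto
    fix \<omega> assume "\<omega> \<in> space M"
    then have "g (1 / real (card {1..Suc n}) * (\<Sum>j=1..Suc n. ?T j \<omega>)) \<le>
        1 / real (card {1..Suc n}) * (\<Sum>j=1..Suc n. g (?T j \<omega>))"
      by (intro convex_on_mean_le[OF J(2)] TJ) auto
    then show "g (1 / real (Suc n) * (\<Sum>i=1..Suc n. Y i \<omega>)) \<le>
        1 / real (Suc n) * (\<Sum>j=1..Suc n. g (?T j \<omega>))"
      by (simp only: mean_eq_mean_leave_one_out[OF n, of "\<lambda>i. Y i \<omega>", symmetric]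
          card_atLeastAtMost diff_Suc_1)
  qed
  also have "\<dots> = 1 / real (Suc n) * (\<Sum>j=1..Suc n. \<integral>\<omega>. g (?T j \<omega>) \<partial>M)"
  proof -
    have "(\<integral>\<omega>. (\<Sum>j=1..Suc n. g (?T j \<omega>)) \<partial>M) = (\<Sum>j=1..Suc n. \<integral>\<omega>. g (?T j \<omega>) \<partial>M)"
      by (intro Bochner_Integration.integral_sum intT)
    then show ?thesis
      by (simp only: Bochner_Integration.integral_mult_right_zero)
  qed
  also have "\<dots> = (\<integral>\<omega>. g (1 / real n * (\<Sum>i=1..n. Y i \<omega>)) \<partial>M)"
  proof -
    have "(\<Sum>j=1..Suc n. \<integral>\<omega>. g (?T j \<omega>) \<partial>M) =
        (\<Sum>j=1..Suc n. \<integral>\<omega>. g (1 / real n * (\<Sum>i=1..n. Y i \<omega>)) \<partial>M)"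
      by (intro sum.cong refl same)
    then show ?thesis
      by (simp only: sum_constant card_atLeastAtMost diff_Suc_1) simp
  qed
  finally show ?le .
qed

section \<open>Expectations of quasi-arithmetic means\<close>

lemma ext_expectation_integrable:
  assumes "integrable M X"
  shows "ext_expectation M X = ereal (\<integral>\<omega>. X \<omega> \<partial>M)"
proof -
  have "ext_expectation M X = enn2ereal (\<integral>\<^sup>+\<omega>. ennreal (X \<omega>) \<partial>M) - enn2ereal (\<integral>\<^sup>+\<omega>. ennreal (- X \<omega>) \<partial>M)"
    by (simp add: ext_expectation_def ennreal_max_0)
  moreover have "(\<integral>\<^sup>+\<omega>. ennreal (X \<omega>) \<partial>M) < \<infinity>" "(\<integral>\<^sup>+\<omega>. ennreal (- X \<omega>) \<partial>M) < \<infinity>"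
    using assms by (auto simp: real_integrable_def less_top)
  ultimately show ?thesis
    using real_lebesgue_integral_def[OF assms]
    by (cases "\<integral>\<^sup>+\<omega>. ennreal (X \<omega>) \<partial>M"; cases "\<integral>\<^sup>+\<omega>. ennreal (- X \<omega>) \<partial>M") (auto simp: enn2ereal_ennreal)
qed

theorem theorem4p3:
  fixes M :: "'a measure" and I :: "real set" and f L :: "real \<Rightarrow> real"
    and \<xi> :: "nat \<Rightarrow> 'a \<Rightarrow> real" and \<mu> \<rho> :: real
  assumes "prob_space M"
    and "I \<noteq> {}" and "open I" and "is_interval I"
    and "continuous_on I f" and "strict_mono_on I f"
    and "exchangeable M \<xi>"
    and "\<And>i \<omega>. i \<ge> 1 \<Longrightarrow> \<omega> \<in> space M \<Longrightarrow> \<xi> i \<omega> \<in> I"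
    and "integrable M (\<lambda>\<omega>. f (\<xi> 1 \<omega>))"
    and "integrable M (\<lambda>\<omega>. (f (\<xi> 1 \<omega>) - prob_space.expectation M (\<lambda>\<omega>. f (\<xi> 1 \<omega>)))\<^sup>2)"
    and "prob_space.variance M (\<lambda>\<omega>. f (\<xi> 1 \<omega>)) > 0"
    and "\<mu> \<ge> 0"
    and "strongly_convex_on (f ` I) \<mu> (L \<circ> the_inv_into I f)"
    and "integrable M (\<lambda>\<omega>. L (\<xi> 1 \<omega>))"
    and "\<rho> = covariance M (\<lambda>\<omega>. f (\<xi> 1 \<omega>)) (\<lambda>\<omega>. f (\<xi> 2 \<omega>)) /
             sqrt (prob_space.variance M (\<lambda>\<omega>. f (\<xi> 1 \<omega>)) * prob_space.variance M (\<lambda>\<omega>. f (\<xi> 2 \<omega>)))"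
  shows "(\<forall>n\<ge>1.
            (\<lambda>\<omega>. L (quasi_arith_mean I f n (\<lambda>i. \<xi> i \<omega>))) \<in> borel_measurable M \<and>
            integrable M (\<lambda>\<omega>. max 0 (L (quasi_arith_mean I f n (\<lambda>i. \<xi> i \<omega>)))) \<and>
            ext_expectation M (\<lambda>\<omega>. L (quasi_arith_mean I f n (\<lambda>i. \<xi> i \<omega>))) < \<infinity>) \<and>
         antimono_on {1..} (\<lambda>n.
            ext_expectation M (\<lambda>\<omega>. L (quasi_arith_mean I f n (\<lambda>i. \<xi> i \<omega>)))
            - ereal (\<mu> * (1 - \<rho>) / real n * prob_space.variance M (\<lambda>\<omega>. f (\<xi> 1 \<omega>))))"
proof -
  interpret prob_space M by fact
  define J where "J = f ` I"
  define \<Lambda> where "\<Lambda> = L \<circ> the_inv_into I f"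
  \<comment> \<open>\<open>f\<close> is only controlled on \<open>I\<close>; cutting it off outside \<open>I\<close> makes \<open>Y i\<close> a Borel function
    of \<open>\<xi> i\<close>, so that \<open>Y\<close> inherits exchangeability.\<close>
  define Y where "Y i \<omega> = indicator I (\<xi> i \<omega>) *\<^sub>R f (\<xi> i \<omega>)" for i \<omega>
  define S where "S n \<omega> = 1 / real n * (\<Sum>i=1..n. Y i \<omega>)" for n \<omega>
  define m where "m = expectation (Y 1)"
  define q where "q = expectation (\<lambda>\<omega>. Y 1 \<omega> * Y 2 \<omega>)"
  define v where "v = expectation (\<lambda>\<omega>. (Y 1 \<omega>)\<^sup>2)"
  define g where "g x = \<Lambda> x - \<mu> * x\<^sup>2" for x
  note \<xi>I = assms(8)
  have inj: "inj_on f I"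
    using assms(6) by (rule strict_mono_on_imp_inj_on)
  have J: "open J"
    unfolding J_def using assms(3,5) inj by (intro invariance_of_domain)
  have g: "convex_on J g"
    unfolding g_def[abs_def] \<Lambda>_def J_def by (rule strongly_convex_on_imp_convex_on) fact
  have Yf: "Y i \<omega> = f (\<xi> i \<omega>)" if "i \<ge> 1" "\<omega> \<in> space M" for i \<omega>
    using \<xi>I that by (simp add: Y_def)
  have YJ: "Y i \<omega> \<in> J" if "i \<ge> 1" "\<omega> \<in> space M" for i \<omega>
    using Yf[OF that] \<xi>I[OF that] by (simp add: J_def)
  have Y: "exchangeable M Y"
  proof -
    have "(\<lambda>x. indicator I x *\<^sub>R f x) \<in> borel_measurable borel"
      using assms(3,5) by (intro borel_measurable_continuous_on_indicator) auto
    from exchangeable_borel_image[OF assms(7) this] show ?thesis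
      unfolding Y_def .
  qed
  have \<Lambda>Y: "\<Lambda> (Y 1 \<omega>) = L (\<xi> 1 \<omega>)" if "\<omega> \<in> space M" for \<omega>
    using Yf[OF _ that] \<xi>I[OF _ that] by (simp add: \<Lambda>_def the_inv_into_f_f[OF inj])
  have mean: "L (quasi_arith_mean I f n (\<lambda>i. \<xi> i \<omega>)) = \<Lambda> (S n \<omega>)" if "\<omega> \<in> space M" for n \<omega>
  proof -
    have "(\<Sum>i=1..n. f (\<xi> i \<omega>)) = (\<Sum>i=1..n. Y i \<omega>)"
      using Yf[OF _ that] by (intro sum.cong) auto
    then show ?thesis
      by (simp add: quasi_arith_mean_def \<Lambda>_def S_def)
  qed

  have intY1: "integrable M (Y 1)"
    using assms(9) by (rule Bochner_Integration.integrable_cong[THEN iffD1, rotated -1]) (auto simp: Yf)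
  have m: "m = expectation (\<lambda>\<omega>. f (\<xi> 1 \<omega>))"
    unfolding m_def by (intro Bochner_Integration.integral_cong) (auto simp: Yf)
  have int_centred: "integrable M (\<lambda>\<omega>. (Y 1 \<omega> - m)\<^sup>2)"
    using assms(10) unfolding m[symmetric]
    by (rule Bochner_Integration.integrable_cong[THEN iffD1, rotated -1]) (auto simp: Yf)
  have sq: "integrable M (\<lambda>\<omega>. (Y 1 \<omega>)\<^sup>2)"
  proof -
    have "integrable M (\<lambda>\<omega>. (Y 1 \<omega> - m)\<^sup>2 + (2 * m * Y 1 \<omega> - m\<^sup>2))"
      using int_centred intY1 by auto
    then show ?thesis
      by (rule Bochner_Integration.integrable_cong[THEN iffD1, rotated -1])
        (auto simp: power2_eq_square algebra_simps)
  qed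
  have marginal: "integrable M (\<lambda>\<omega>. (Y 2 \<omega>)\<^sup>2)" "expectation (\<lambda>\<omega>. (Y 2 \<omega>)\<^sup>2) = v"
    "integrable M (Y 2)" "expectation (Y 2) = m"
    using exchangeable_marginal[OF Y, of 2 "\<lambda>x. x\<^sup>2"] exchangeable_marginal[OF Y, of 2 "\<lambda>x. x"] sq intY1
    by (auto simp: v_def m_def)
  have m2: "expectation (\<lambda>\<omega>. f (\<xi> 2 \<omega>)) = m"
    unfolding marginal(4)[symmetric] by (intro Bochner_Integration.integral_cong) (auto simp: Yf)
  have var: "variance (\<lambda>\<omega>. f (\<xi> i \<omega>)) = v - m\<^sup>2" if "i \<in> {1, 2}" for i
  proof -
    have "variance (\<lambda>\<omega>. f (\<xi> i \<omega>)) = expectation (\<lambda>\<omega>. (Y i \<omega> - m)\<^sup>2)"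
      using that m m2 by (intro Bochner_Integration.integral_cong) (auto simp: Yf)
    also have "\<dots> = variance (Y i)"
      using that marginal by (auto simp: m_def)
    also have "\<dots> = v - m\<^sup>2"
      using that variance_eq[OF intY1 sq] variance_eq[OF marginal(3,1)] marginal
      by (auto simp: v_def m_def)
    finally show ?thesis .
  qed
  have int12: "integrable M (\<lambda>\<omega>. Y 1 \<omega> * Y 2 \<omega>)"
    using intY1 sq marginal by (intro integrable_mult_of_squares) auto
  have cov: "covariance M (\<lambda>\<omega>. f (\<xi> 1 \<omega>)) (\<lambda>\<omega>. f (\<xi> 2 \<omega>)) = q - m\<^sup>2"
  proof -
    have "covariance M (\<lambda>\<omega>. f (\<xi> 1 \<omega>)) (\<lambda>\<omega>. f (\<xi> 2 \<omega>)) =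
        expectation (\<lambda>\<omega>. Y 1 \<omega> * Y 2 \<omega> - m * Y 1 \<omega> - m * Y 2 \<omega> + m\<^sup>2)"
      unfolding covariance_def m[symmetric] m2
      by (intro Bochner_Integration.integral_cong)
        (auto simp: Yf power2_eq_square algebra_simps)
    also have "\<dots> = q - m * m - m * m + m\<^sup>2"
      using int12 intY1 marginal m_def by (simp add: q_def prob_space)
    finally show ?thesis
      by (simp add: power2_eq_square)
  qed
  \<comment> \<open>Both variances equal \<open>v - m\<^sup>2 > 0\<close>, so \<open>\<rho> = (q - m\<^sup>2) / (v - m\<^sup>2)\<close>.\<close>
  have corr: "(1 - \<rho>) * (v - m\<^sup>2) = v - q"
  proof -
    have "v - m\<^sup>2 > 0"
      using assms(11) var[of 1] by simp
    moreover have "variance (\<lambda>\<omega>. f (\<xi> 1 \<omega>)) = v - m\<^sup>2" "variance (\<lambda>\<omega>. f (\<xi> 2 \<omega>)) = v - m\<^sup>2"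
      by (rule var; simp)+
    ultimately have "\<rho> = (q - m\<^sup>2) / (v - m\<^sup>2)"
      unfolding assms(15) cov
      by (simp only: power2_eq_square[symmetric, of "v - _"] real_sqrt_abs abs_of_pos)
    with \<open>v - m\<^sup>2 > 0\<close> have "\<rho> * (v - m\<^sup>2) = q - m\<^sup>2"
      by simp
    then show ?thesis
      by (simp only: left_diff_distrib mult_1_left)
  qed

  have int_g: "integrable M (\<lambda>\<omega>. g (Y 1 \<omega>))"
  proof -
    have "integrable M (\<lambda>\<omega>. L (\<xi> 1 \<omega>) - \<mu> * (Y 1 \<omega>)\<^sup>2)"
      using assms(14) sq by auto
    then show ?thesis
      by (rule Bochner_Integration.integrable_cong[THEN iffD1, rotated -1]) (auto simp: \<Lambda>Y[unfolded One_nat_def] g_def)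
  qed
  note decr = exchangeable_convex_mean_Suc_le[OF finite_measure_axioms J g Y YJ intY1 int_g,
      folded S_def]
  note second = exchangeable_mean_second_moment[OF Y sq, folded S_def q_def v_def]
  have int\<Lambda>: "integrable M (\<lambda>\<omega>. \<Lambda> (S n \<omega>))" if n: "n \<ge> 1" for n
    using Bochner_Integration.integrable_add[OF decr(1)[OF _ _ n] integrable_mult_right[OF second(1)[OF n], of \<mu>]]
    by (simp add: g_def)
  have int_L: "integrable M (\<lambda>\<omega>. L (quasi_arith_mean I f n (\<lambda>i. \<xi> i \<omega>)))" if n: "n \<ge> 1" for n
    using int\<Lambda>[OF n]
    by (rule Bochner_Integration.integrable_cong[THEN iffD1, rotated -1]) (auto simp: mean)
  have ext: "ext_expectation M (\<lambda>\<omega>. L (quasi_arith_mean I f n (\<lambda>i. \<xi> i \<omega>)))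
      = ereal (expectation (\<lambda>\<omega>. \<Lambda> (S n \<omega>)))" if n: "n \<ge> 1" for n
    unfolding ext_expectation_integrable[OF int_L[OF n]]
    using mean by (auto intro!: Bochner_Integration.integral_cong)
  let ?a = "\<lambda>n. ext_expectation M (\<lambda>\<omega>. L (quasi_arith_mean I f n (\<lambda>i. \<xi> i \<omega>)))
            - ereal (\<mu> * (1 - \<rho>) / real n * variance (\<lambda>\<omega>. f (\<xi> 1 \<omega>)))"
  \<comment> \<open>By the second moment formula the subtracted term is \<open>\<mu> E[(S n)\<^sup>2] - \<mu> q\<close>.\<close>
  have a: "?a n = ereal (expectation (\<lambda>\<omega>. g (S n \<omega>)) + \<mu> * q)" if n: "n \<ge> 1" for n
  proof -
    have "expectation (\<lambda>\<omega>. g (S n \<omega>)) = expectation (\<lambda>\<omega>. \<Lambda> (S n \<omega>)) - \<mu> * (q + (v - q) / real n)"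
      unfolding g_def using int\<Lambda>[OF n] second[OF n] by simp
    moreover have "\<mu> * (1 - \<rho>) / real n * variance (\<lambda>\<omega>. f (\<xi> 1 \<omega>)) = \<mu> * ((v - q) / real n)"
    proof -
      have "variance (\<lambda>\<omega>. f (\<xi> 1 \<omega>)) = v - m\<^sup>2"
        by (rule var) simp
      then show ?thesis
        unfolding corr[symmetric] by simp
    qed
    ultimately show ?thesis
      unfolding ext[OF n] by (simp only: ereal_minus(1) ereal.inject distrib_left)
  qed
  have "antimono_on {1..} ?a"
  proof (rule monotone_onI)
    fix k n :: nat assume k: "k \<in> {1..}" and n: "n \<in> {1..}" and "k \<le> n"
    from \<open>k \<le> n\<close> have "expectation (\<lambda>\<omega>. g (S n \<omega>)) \<le> expectation (\<lambda>\<omega>. g (S k \<omega>))"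
    proof (induction rule: dec_induct)
      case (step i)
      with k show ?case
        using decr(2)[of i] by fastforce
    qed simp
    then show "?a k \<ge> ?a n"
      using a k n by simp
  qed
  moreover have "integrable M (\<lambda>\<omega>. max 0 (L (quasi_arith_mean I f n (\<lambda>i. \<xi> i \<omega>))))" if "n \<ge> 1" for n
    using int_L[OF that] by (intro Bochner_Integration.integrable_max) auto
  ultimately show ?thesis
    using int_L ext by auto
qed

end
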